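(* For a $d$-space $X$, the following conditions are equivalent: (1) $X$ is well-filtered. (2) For each $A\in \mathsf{WD}(X)$ and each $K\in\mathbf{up}(X)$, $\mathord{\downarrow}(A\cap K)$ is closed in $X$. (3) For each $A\in \mathsf{RD}(X)$ and each $K\in\mathbf{up}(X)$, $\mathord{\downarrow}(A\cap K)$ is closed in $X$. (4) For each $A\in \mathsf{WD}(X)$ and each $K\in\mathsf{K}(X)$, $\mathord{\downarrow}(A\cap K)$ is closed in $X$. (5) For each $A\in \mathsf{RD}(X)$ and each $K\in\mathsf{K}(X)$, $\mathord{\downarrow}(A\cap K)$ is closed in $X$.
   Context: A $T_0$ space $X$ is regarded as a poset under its specialization order: $x\leq y$ iff $x\in\overline{\{y\}}$. $\mathord{\downarrow}$ denotes lower closure in this order. A dcpo is a poset in which every (nonempty) directed subset has a supremum; a subset $U$ of a poset is Scott open if it is an upper set and, for every directed $D$ whose supremum exists, $\bigvee D\in U$ implies $D\cap U\ne\emptyset$. A $T_0$ space $X$ is a $d$-space if it is a dcpo in its specialization order and every open set is Scott open. $\mathbf{up}(X)$ is the set of all nonempty upper subsets of $X$. A set is saturated if it is an intersection of open sets (equivalently, an upper set); $\mathsf{K}(X)$ is the set of all nonempty compact saturated subsets of $X$. A family $\mathcal K\subseteq\mathsf{K}(X)$ is filtered if it is nonempty and any two members contain a common third member. $X$ is well-filtered if it is $T_0$ and for every open $U$ and every filtered $\mathcal K\subseteq\mathsf{K}(X)$, $\bigcap\mathcal K\subseteq U$ implies $K\subseteq U$ for some $K\in\mathcal K$. $\mathsf{RD}(X)$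 is the set of nonempty closed subsets $A$ of $X$ for which there is a filtered family $\mathcal K\subseteq\mathsf{K}(X)$ such that $A$ is minimal (under inclusion) among the closed sets meeting every member of $\mathcal K$. $\mathsf{WD}(X)$ is the set of closed subsets $A$ of $X$ such that for every continuous map $f:X\to Y$ into a well-filtered space $Y$ there is a unique $y\in Y$ with $\overline{f(A)}=\overline{\{y\}}$. *)

theory Defs
  imports "HOL-Analysis.Analysis"
begin

section \<open>Posets given by a carrier and an order relation\<close>

definition directed_in :: "'a set \<Rightarrow> ('a \<Rightarrow> 'a \<Rightarrow> bool) \<Rightarrow> 'a set \<Rightarrow> bool" where
  "directed_in P le D \<longleftrightarrow>
     D \<subseteq> P \<and> D \<noteq> {} \<and> (\<forall>x\<in>D. \<forall>y\<in>D. \<exists>z\<in>D. le x z \<and> le y z)"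

definition is_sup_in :: "'a set \<Rightarrow> ('a \<Rightarrow> 'a \<Rightarrow> bool) \<Rightarrow> 'a set \<Rightarrow> 'a \<Rightarrow> bool" where
  "is_sup_in P le D s \<longleftrightarrow>
     s \<in> P \<and> (\<forall>x\<in>D. le x s) \<and> (\<forall>u\<in>P. (\<forall>x\<in>D. le x u) \<longrightarrow> le s u)"

definition dcpo_on :: "'a set \<Rightarrow> ('a \<Rightarrow> 'a \<Rightarrow> bool) \<Rightarrow> bool" where
  "dcpo_on P le \<longleftrightarrow> (\<forall>D. directed_in P le D \<longrightarrow> (\<exists>s. is_sup_in P le D s))"

definition upper_in :: "'a set \<Rightarrow> ('a \<Rightarrow> 'a \<Rightarrow> bool) \<Rightarrow> 'a set \<Rightarrow> bool" where
  "upper_in P le U \<longleftrightarrow> U \<subseteq> P \<and> (\<forall>x\<in>U. \<forall>y\<in>P. le x y \<longrightarrow> y \<in> U)"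

definition lower_closure_in :: "'a set \<Rightarrow> ('a \<Rightarrow> 'a \<Rightarrow> bool) \<Rightarrow> 'a set \<Rightarrow> 'a set" where
  "lower_closure_in P le S = {x \<in> P. \<exists>s\<in>S. le x s}"

definition scott_open_in :: "'a set \<Rightarrow> ('a \<Rightarrow> 'a \<Rightarrow> bool) \<Rightarrow> 'a set \<Rightarrow> bool" where
  "scott_open_in P le U \<longleftrightarrow>
     upper_in P le U \<and>
     (\<forall>D s. directed_in P le D \<and> is_sup_in P le D s \<and> s \<in> U \<longrightarrow> D \<inter> U \<noteq> {})"

section \<open>The specialization order\<close>

definition spec_le :: "'a topology \<Rightarrow> 'a \<Rightarrow> 'a \<Rightarrow> bool" where
  "spec_le X x y \<longleftrightarrow> x \<in> X closure_of {y}"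

abbreviation down :: "'a topology \<Rightarrow> 'a set \<Rightarrow> 'a set" where
  "down X \<equiv> lower_closure_in (topspace X) (spec_le X)"

definition d_space :: "'a topology \<Rightarrow> bool" where
  "d_space X \<longleftrightarrow>
     t0_space X \<and> dcpo_on (topspace X) (spec_le X) \<and>
     (\<forall>U. openin X U \<longrightarrow> scott_open_in (topspace X) (spec_le X) U)"

definition up_sets :: "'a topology \<Rightarrow> 'a set set" where
  "up_sets X = {U. U \<noteq> {} \<and> upper_in (topspace X) (spec_le X) U}"

section \<open>Compact saturated sets and well-filtered spaces\<close>

text \<open>The intersection with \<^term>\<open>topspace X\<close> makes the empty intersection the whole space.\<close>

definition saturated_in :: "'a topology \<Rightarrow> 'a set \<Rightarrow> bool" where
  "saturated_in X S \<longleftrightarrow> (\<exists>\<U>. (\<forall>U\<in>\<U>. openin X U) \<and> S = topspace X \<inter> \<Inter>\<U>)"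

definition compact_saturated_sets :: "'a topology \<Rightarrow> 'a set set" where
  "compact_saturated_sets X = {K. K \<noteq> {} \<and> compactin X K \<and> saturated_in X K}"

definition filtered_family :: "'a set set \<Rightarrow> bool" where
  "filtered_family \<K> \<longleftrightarrow>
     \<K> \<noteq> {} \<and> (\<forall>K1\<in>\<K>. \<forall>K2\<in>\<K>. \<exists>K3\<in>\<K>. K3 \<subseteq> K1 \<and> K3 \<subseteq> K2)"

definition well_filtered_space :: "'a topology \<Rightarrow> bool" where
  "well_filtered_space X \<longleftrightarrow>
     t0_space X \<and>
     (\<forall>U \<K>. openin X U \<and> \<K> \<subseteq> compact_saturated_sets X \<and> filtered_family \<K> \<and> \<Inter>\<K> \<subseteq> U
        \<longrightarrow> (\<exists>K\<in>\<K>. K \<subseteq> U))"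

section \<open>Rudin sets and well-filtered determined sets\<close>

definition closed_meeting :: "'a topology \<Rightarrow> 'a set set \<Rightarrow> 'a set set" where
  "closed_meeting X \<K> = {C. closedin X C \<and> (\<forall>K\<in>\<K>. C \<inter> K \<noteq> {})}"

definition RD :: "'a topology \<Rightarrow> 'a set set" where
  "RD X = {A. A \<noteq> {} \<and> closedin X A \<and>
     (\<exists>\<K>. \<K> \<subseteq> compact_saturated_sets X \<and> filtered_family \<K> \<and>
        A \<in> closed_meeting X \<K> \<and>
        (\<forall>C\<in>closed_meeting X \<K>. C \<subseteq> A \<longrightarrow> C = A))}"

text \<open>A formula cannot quantify over all types, so the test spaces \<open>Y\<close> below have their points in
  \<^typ>\<open>'a set\<close>. This is no restriction: by \<open>WD_all_spaces\<close> below, a member of \<open>WD X\<close> satisfies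
  the defining condition for well-filtered spaces over every type.\<close>

definition WD :: "'a topology \<Rightarrow> 'a set set" where
  "WD X = {A. closedin X A \<and>
     (\<forall>(Y :: 'a set topology) f. well_filtered_space Y \<and> continuous_map X Y f \<longrightarrow>
        (\<exists>!y. y \<in> topspace Y \<and> Y closure_of (f ` A) = Y closure_of {y}))}"

section \<open>Test spaces over arbitrary types\<close>

lemma t0_closure_inj:
  assumes "t0_space Y" "x \<in> topspace Y" "y \<in> topspace Y" "Y closure_of {x} = Y closure_of {y}"
  shows "x = y"
proof (rule ccontr)
  assume "x \<noteq> y"
  then obtain U where U: "openin Y U" "x \<notin> U \<longleftrightarrow> y \<in> U"
    using assms(1-3) unfolding t0_space_def by blast
  have "x \<in> Y closure_of {y}" "y \<in> Y closure_of {x}"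
    using assms closure_of_subset[of "{x}" Y] closure_of_subset[of "{y}" Y] by auto
  then show False using U unfolding in_closure_of by blast
qed

lemma closed_meeting_minimal:
  assumes K: "\<forall>K\<in>\<K>. compactin X K" and C: "C \<in> closed_meeting X \<K>"
  obtains A where "A \<in> closed_meeting X \<K>" "A \<subseteq> C"
    "\<And>B. B \<in> closed_meeting X \<K> \<Longrightarrow> B \<subseteq> A \<Longrightarrow> B = A"
proof -
  define F where "F = {U. topspace X - U \<in> closed_meeting X \<K> \<and> topspace X - C \<subseteq> U \<and> U \<subseteq> topspace X}"
  have CX: "C \<subseteq> topspace X"
    using C closedin_subset by (auto simp: closed_meeting_def)
  have dC: "topspace X - (topspace X - C) = C" using CX by blast
  have ne: "F \<noteq> {}"
    using C dC unfolding F_def by (auto intro!: exI[of _ "topspace X - C"])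
  have "\<exists>M\<in>F. \<forall>U\<in>F. M \<subseteq> U \<longrightarrow> U = M"
  proof (rule subset_Zorn_nonempty[OF ne])
    fix Ch assume Ch: "Ch \<noteq> {}" "subset.chain F Ch"
    have ChF: "Ch \<subseteq> F" using Ch(2) by (simp add: subset.chain_def)
    define G where "G = (\<lambda>U. topspace X - U) ` Ch"
    have Gcl: "\<forall>B\<in>G. closedin X B"
      using ChF by (auto simp: G_def F_def closed_meeting_def)
    have eq: "topspace X - \<Union>Ch = \<Inter>G" using Ch(1) by (auto simp: G_def)
    have "\<Inter>G \<inter> K \<noteq> {}" if KK: "K \<in> \<K>" for K
    proof -
      have "K \<inter> \<Inter>\<F> \<noteq> {}" if fin: "finite \<F>" "\<F> \<subseteq> G" for \<F>
      proof (cases "\<F> = {}")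
        case True
        then show ?thesis using C KK by (auto simp: closed_meeting_def)
      next
        case False
        obtain V where V: "V \<subseteq> Ch" "finite V" "\<F> = (\<lambda>U. topspace X - U) ` V"
          using fin unfolding G_def by (meson finite_subset_image)
        have Vne: "V \<noteq> {}" using False V by blast
        have "subset.chain F V" using V(1) Ch(2) unfolding subset.chain_def by blast
        then have "\<Union>V \<in> V" using V(2) Vne
          by (simp add: Union_in_chain)
        then have "\<Union>V \<in> F" using V(1) ChF by blast
        moreover have "\<Inter>\<F> = topspace X - \<Union>V" using V(3) Vne by auto
        ultimately show ?thesis using KK by (auto simp: F_def closed_meeting_def)
      qed
      then have fip: "\<forall>\<F>. finite \<F> \<and> \<F> \<subseteq> G \<longrightarrow> K \<inter> \<Inter>\<F> \<noteq> {}" by simp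
      have "compactin X K" using K KK by blast
      then have "K \<inter> \<Inter>G \<noteq> {}"
        unfolding compactin_fip by (metis Gcl fip)
      then show ?thesis by blast
    qed
    moreover have "closedin X (\<Inter>G)"
    proof (rule closedin_Inter)
      show "G \<noteq> {}" using Ch(1) by (simp add: G_def)
    qed (use Gcl in blast)
    ultimately have "topspace X - \<Union>Ch \<in> closed_meeting X \<K>"
      unfolding eq closed_meeting_def by blast
    moreover have "topspace X - C \<subseteq> \<Union>Ch" "\<Union>Ch \<subseteq> topspace X"
      using Ch(1) ChF by (auto simp: F_def)
    ultimately show "\<Union>Ch \<in> F" by (simp add: F_def)
  qed
  then obtain M where M: "M \<in> F" "\<And>U. U \<in> F \<Longrightarrow> M \<subseteq> U \<Longrightarrow> U = M" by blast
  show thesis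
  proof (rule that[of "topspace X - M"])
    show "topspace X - M \<in> closed_meeting X \<K>" "topspace X - M \<subseteq> C"
      using M(1) by (auto simp: F_def)
    fix B assume B: "B \<in> closed_meeting X \<K>" "B \<subseteq> topspace X - M"
    have dB: "topspace X - (topspace X - B) = B" using B(2) by blast
    have "topspace X - B \<in> F"
      using B M(1) dB unfolding F_def by auto
    moreover have "M \<subseteq> topspace X - B" using B(2) M(1) by (auto simp: F_def)
    ultimately have "topspace X - B = M" using M(2) by blast
    then show "B = topspace X - M" using dB by auto
  qed
qed

definition saturation :: "'a topology \<Rightarrow> 'a set \<Rightarrow> 'a set" where
  "saturation X S = topspace X \<inter> \<Inter>{U. openin X U \<and> S \<subseteq> U}"

lemma saturation_superset: "S \<subseteq> topspace X \<Longrightarrow> S \<subseteq> saturation X S"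
  by (auto simp: saturation_def)

lemma saturation_mono: "S \<subseteq> T \<Longrightarrow> saturation X S \<subseteq> saturation X T"
  by (auto simp: saturation_def)

lemma saturation_subset_open: "openin X U \<Longrightarrow> S \<subseteq> U \<Longrightarrow> saturation X S \<subseteq> U"
  by (auto simp: saturation_def)

lemma saturation_closure_meets:
  assumes "x \<in> saturation X S" "S \<subseteq> topspace X"
  shows "X closure_of {x} \<inter> S \<noteq> {}"
proof
  assume "X closure_of {x} \<inter> S = {}"
  then have "S \<subseteq> topspace X - X closure_of {x}" using assms(2) by blast
  moreover have "openin X (topspace X - X closure_of {x})" by (simp add: openin_diff)
  ultimately have "x \<notin> X closure_of {x}"
    using assms(1) unfolding saturation_def by blast
  moreover have "x \<in> topspace X" using assms(1) by (simp add: saturation_def)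
  ultimately show False using closure_of_subset[of "{x}" X] by auto
qed

lemma saturation_compact_saturated:
  assumes "compactin X S" "S \<noteq> {}"
  shows "saturation X S \<in> compact_saturated_sets X"
proof -
  have sub: "S \<subseteq> saturation X S"
    by (simp add: assms(1) compactin_subset_topspace saturation_superset)
  have "compactin X (saturation X S)"
    unfolding compactin_def
  proof (intro conjI allI impI)
    show "saturation X S \<subseteq> topspace X" by (auto simp: saturation_def)
    fix \<U> assume U: "Ball \<U> (openin X) \<and> saturation X S \<subseteq> \<Union>\<U>"
    then obtain \<F> where F: "finite \<F>" "\<F> \<subseteq> \<U>" "S \<subseteq> \<Union>\<F>"
      using assms(1) sub unfolding compactin_def by (meson subset_trans)
    have "openin X (\<Union>\<F>)" using U F(2) by blast
    then have "saturation X S \<subseteq> \<Union>\<F>" using F(3) saturation_subset_open by blast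
    then show "\<exists>\<F>. finite \<F> \<and> \<F> \<subseteq> \<U> \<and> saturation X S \<subseteq> \<Union>\<F>" using F by blast
  qed
  moreover have "saturated_in X (saturation X S)"
    unfolding saturated_in_def saturation_def by (rule exI[of _ "{U. openin X U \<and> S \<subseteq> U}"]) auto
  ultimately show ?thesis using sub assms(2) by (auto simp: compact_saturated_sets_def)
qed

lemma saturated_in_upward:
  assumes "saturated_in X S" "X closure_of {x} \<inter> S \<noteq> {}" "x \<in> topspace X"
  shows "x \<in> S"
proof -
  obtain \<U> where U: "\<forall>U\<in>\<U>. openin X U" "S = topspace X \<inter> \<Inter>\<U>"
    using assms(1) by (auto simp: saturated_in_def)
  obtain s where s: "s \<in> X closure_of {x}" "s \<in> S" using assms(2) by blast
  have "x \<in> U" if "U \<in> \<U>" for U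
    using s U that unfolding in_closure_of by blast
  then show ?thesis using U(2) assms(3) by blast
qed

lemma well_filtered_initial:
  assumes wf: "well_filtered_space Y" and t0: "t0_space Z" and g: "continuous_map Z Y g"
    and initial: "\<And>V. openin Z V \<Longrightarrow> \<exists>U. openin Y U \<and> V = {z \<in> topspace Z. g z \<in> U}"
    and points: "\<And>A y. \<lbrakk>closedin Z A; y \<in> topspace Y; Y closure_of (g ` A) = Y closure_of {y}\<rbrakk>
                   \<Longrightarrow> \<exists>z\<in>topspace Z. g z = y"
  shows "well_filtered_space Z"
  unfolding well_filtered_space_def
proof (intro conjI t0 allI impI)
  fix U \<K>
  assume *: "openin Z U \<and> \<K> \<subseteq> compact_saturated_sets Z \<and> filtered_family \<K> \<and> \<Inter>\<K> \<subseteq> U"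
  show "\<exists>K\<in>\<K>. K \<subseteq> U"
  proof (rule ccontr)
    assume no: "\<not> (\<exists>K\<in>\<K>. K \<subseteq> U)"
    have Kc: "\<forall>K\<in>\<K>. compactin Z K" using * by (auto simp: compact_saturated_sets_def)
    have "(topspace Z - U) \<inter> K \<noteq> {}" if "K \<in> \<K>" for K
      using no Kc compactin_subset_topspace that by blast
    then have "topspace Z - U \<in> closed_meeting Z \<K>"
      using * by (simp add: closed_meeting_def closedin_diff)
    then obtain A where A: "A \<in> closed_meeting Z \<K>" "A \<subseteq> topspace Z - U"
      and Amin: "\<And>B. B \<in> closed_meeting Z \<K> \<Longrightarrow> B \<subseteq> A \<Longrightarrow> B = A"
      using closed_meeting_minimal[OF Kc] by blast
    have Acl: "closedin Z A" using A by (simp add: closed_meeting_def)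
    have AZ: "A \<subseteq> topspace Z" using Acl closedin_subset by blast
    have gA: "g ` A \<subseteq> topspace Y" using AZ g by (auto simp: continuous_map_def)
    define S where "S K = saturation Y (g ` (A \<inter> K))" for K
    have SK: "S ` \<K> \<subseteq> compact_saturated_sets Y"
    proof
      fix T assume "T \<in> S ` \<K>"
      then obtain K where K: "K \<in> \<K>" "T = S K" by blast
      have "compactin Y (g ` (A \<inter> K))"
        using Acl K(1) Kc g by (meson closed_Int_compactin image_compactin)
      moreover have "g ` (A \<inter> K) \<noteq> {}" using A(1) K(1) by (simp add: closed_meeting_def)
      ultimately show "T \<in> compact_saturated_sets Y"
        unfolding K(2) S_def by (rule saturation_compact_saturated)
    qed
    have filt: "filtered_family (S ` \<K>)"
      unfolding filtered_family_def
    proof (intro conjI ballI)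
      show "S ` \<K> \<noteq> {}" using * by (auto simp: filtered_family_def)
      fix T1 T2 assume "T1 \<in> S ` \<K>" "T2 \<in> S ` \<K>"
      then obtain K1 K2 where K: "K1 \<in> \<K>" "K2 \<in> \<K>" "T1 = S K1" "T2 = S K2" by blast
      then obtain K3 where K3: "K3 \<in> \<K>" "K3 \<subseteq> K1" "K3 \<subseteq> K2"
        using * unfolding filtered_family_def by blast
      have "S K3 \<subseteq> T1" "S K3 \<subseteq> T2"
        unfolding K S_def by (rule saturation_mono; use K3 in blast)+
      then show "\<exists>T3\<in>S ` \<K>. T3 \<subseteq> T1 \<and> T3 \<subseteq> T2" using K3(1) by blast
    qed
    define W where "W = topspace Y - Y closure_of (g ` A)"
    have Wop: "openin Y W" by (simp add: W_def openin_diff)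
    have "\<not> S K \<subseteq> W" if "K \<in> \<K>" for K
    proof -
      have "A \<inter> K \<noteq> {}" using A(1) that by (simp add: closed_meeting_def)
      then obtain a where "a \<in> A" "a \<in> K" by blast
      then have "g a \<in> S K" "g a \<notin> W"
        using gA saturation_superset[of "g ` (A \<inter> K)" Y] closure_of_subset[OF gA]
        by (auto simp: S_def W_def)
      then show ?thesis by blast
    qed
    then have "\<not> \<Inter>(S ` \<K>) \<subseteq> W"
      using wf Wop SK filt unfolding well_filtered_space_def by (metis (full_types) imageE)
    then obtain y where y: "\<And>K. K \<in> \<K> \<Longrightarrow> y \<in> S K" "y \<notin> W" by blast
    have "\<K> \<noteq> {}" using * by (simp add: filtered_family_def)
    then have yY: "y \<in> topspace Y" using y(1) by (auto simp: S_def saturation_def)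
    then have ycl: "y \<in> Y closure_of (g ` A)" using y(2) by (simp add: W_def)
    define B where "B = A \<inter> {z \<in> topspace Z. g z \<in> Y closure_of {y}}"
    have "closedin Z {z \<in> topspace Z. g z \<in> Y closure_of {y}}"
      using g closedin_continuous_map_preimage closedin_closure_of by blast
    then have "closedin Z B" using Acl by (simp add: B_def closedin_Int)
    moreover have BK: "B \<inter> K \<noteq> {}" if "K \<in> \<K>" for K
    proof -
      have "Y closure_of {y} \<inter> g ` (A \<inter> K) \<noteq> {}"
        using saturation_closure_meets[of y Y "g ` (A \<inter> K)"] y(1)[OF that] gA by (auto simp: S_def)
      then show ?thesis using AZ by (auto simp: B_def)
    qed
    ultimately have "B \<in> closed_meeting Z \<K>" by (simp add: closed_meeting_def)
    then have "B = A" using Amin by (simp add: B_def)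
    then have "g ` A \<subseteq> Y closure_of {y}" by (auto simp: B_def)
    then have "Y closure_of (g ` A) = Y closure_of {y}"
      using ycl by (intro subset_antisym closure_of_minimal) auto
    then obtain z where z: "z \<in> topspace Z" "g z = y" using points Acl yY by blast
    have clz: "Z closure_of {z} = {w \<in> topspace Z. g w \<in> Y closure_of {y}}"
    proof
      show "Z closure_of {z} \<subseteq> {w \<in> topspace Z. g w \<in> Y closure_of {y}}"
      proof (rule closure_of_minimal)
        show "closedin Z {w \<in> topspace Z. g w \<in> Y closure_of {y}}" by fact
        show "{z} \<subseteq> {w \<in> topspace Z. g w \<in> Y closure_of {y}}"
          using z yY closure_of_subset[of "{y}" Y] by auto
      qed
      show "{w \<in> topspace Z. g w \<in> Y closure_of {y}} \<subseteq> Z closure_of {z}"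
      proof
        fix w assume w: "w \<in> {w \<in> topspace Z. g w \<in> Y closure_of {y}}"
        have "z \<in> V" if V: "w \<in> V" "openin Z V" for V
        proof -
          obtain U' where U': "openin Y U'" "V = {z \<in> topspace Z. g z \<in> U'}"
            using initial V(2) by blast
          then show ?thesis using w V(1) z by (auto simp: in_closure_of)
        qed
        then show "w \<in> Z closure_of {z}" using w by (auto simp: in_closure_of)
      qed
    qed
    have zK: "z \<in> K" if "K \<in> \<K>" for K
    proof (rule saturated_in_upward)
      show "saturated_in Z K" using * that by (auto simp: compact_saturated_sets_def)
      show "Z closure_of {z} \<inter> K \<noteq> {}" using BK[OF that] unfolding clz B_def by blast
    qed (fact z(1))
    then have "z \<in> U" using * by blast
    moreover have "z \<in> A"
    proof -
      have "z \<in> V \<Longrightarrow> openin Z V \<Longrightarrow> \<exists>a\<in>A. a \<in> V" for V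
      proof -
        assume V: "z \<in> V" "openin Z V"
        then obtain U' where U': "openin Y U'" "V = {z \<in> topspace Z. g z \<in> U'}"
          using initial by blast
        then have "y \<in> U'" using V z by auto
        then obtain a where "a \<in> A" "g a \<in> U'"
          using ycl U'(1) unfolding in_closure_of by blast
        then show "\<exists>a\<in>A. a \<in> V" using U'(2) AZ by blast
      qed
      then have "z \<in> Z closure_of A" using z(1) by (auto simp: in_closure_of)
      then show ?thesis using Acl by (simp add: closure_of_closedin)
    qed
    ultimately show False using A(2) by blast
  qed
qed

theorem WD_all_spaces:
  fixes X :: "'a topology" and Y :: "'b topology"
  assumes A: "A \<in> WD X" and wf: "well_filtered_space Y" and f: "continuous_map X Y f"
  shows "\<exists>!y. y \<in> topspace Y \<and> Y closure_of (f ` A) = Y closure_of {y}"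
proof -
  have t0: "t0_space Y" using wf by (simp add: well_filtered_space_def)
  define h where "h C = {x \<in> topspace X. f x \<in> Y closure_of C}" for C
  define Y0 where "Y0 = {y \<in> topspace Y. Y closure_of {y} = Y closure_of (f ` h {y})}"
  define k where "k y = h {y}" for y
  define g where "g = inv_into Y0 k"
  define Z where "Z = pullback_topology (k ` Y0) g Y"
  have fX: "f x \<in> topspace Y" if "x \<in> topspace X" for x
    using f that by (auto simp: continuous_map_def)
  have inj: "inj_on k Y0"
  proof (rule inj_onI)
    fix y y' assume "y \<in> Y0" "y' \<in> Y0" "k y = k y'"
    then show "y = y'" using t0_closure_inj[OF t0] by (auto simp: Y0_def k_def)
  qed
  have gk: "g (k y) = y" if "y \<in> Y0" for y using inj that by (simp add: g_def)
  have gY: "g c \<in> topspace Y" if "c \<in> k ` Y0" for c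
    using gk that by (auto simp: Y0_def)
  have tZ: "topspace Z = k ` Y0"
    unfolding Z_def topspace_pullback_topology using gY by auto
  have opZ: "openin Z V \<longleftrightarrow> (\<exists>U. openin Y U \<and> V = {z \<in> topspace Z. g z \<in> U})" for V
    unfolding tZ unfolding Z_def openin_pullback_topology by (auto simp: vimage_def)
  have gcont: "continuous_map Z Y g"
    unfolding continuous_map_def using gY opZ by (auto simp: tZ)
  have fY0: "f x \<in> Y0" if x: "x \<in> topspace X" for x
  proof -
    have "f x \<in> Y closure_of {f x}" using fX[OF x] closure_of_subset[of "{f x}" Y] by auto
    then have "{f x} \<subseteq> f ` h {f x}" using x by (auto simp: h_def)
    then have "Y closure_of {f x} \<subseteq> Y closure_of (f ` h {f x})" by (rule closure_of_mono)
    moreover have "Y closure_of (f ` h {f x}) \<subseteq> Y closure_of {f x}"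
      by (rule closure_of_minimal) (auto simp: h_def)
    ultimately show ?thesis using fX[OF x] by (auto simp: Y0_def)
  qed
  have t0Z: "t0_space Z"
    unfolding t0_space_def
  proof (intro ballI impI)
    fix c d assume cd: "c \<in> topspace Z" "d \<in> topspace Z" "c \<noteq> d"
    then have "g c \<noteq> g d" "g c \<in> topspace Y" "g d \<in> topspace Y"
      using gk gY by (auto simp: tZ)
    then obtain U where U: "openin Y U" "g c \<notin> U \<longleftrightarrow> g d \<in> U"
      using t0 unfolding t0_space_def by blast
    then show "\<exists>U. openin Z U \<and> (c \<notin> U) = (d \<in> U)"
      using cd opZ by (intro exI[of _ "{z \<in> topspace Z. g z \<in> U}"]) auto
  qed
  have wfZ: "well_filtered_space Z"
  proof (rule well_filtered_initial[OF wf t0Z gcont])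
    fix A' y
    assume A': "closedin Z A'" and y: "y \<in> topspace Y" "Y closure_of (g ` A') = Y closure_of {y}"
    have "g ` A' \<subseteq> Y closure_of (f ` h {y})"
    proof
      fix b assume "b \<in> g ` A'"
      then obtain c where c: "c \<in> A'" "b = g c" by blast
      have "c \<in> k ` Y0" using A' c closedin_subset tZ by blast
      then have b: "b \<in> Y0" using c gk by auto
      have "A' \<subseteq> k ` Y0" using closedin_subset[OF A'] tZ by simp
      then have "g ` A' \<subseteq> topspace Y" using gY by blast
      then have "b \<in> Y closure_of {y}"
        using closure_of_subset[of "g ` A'" Y] c y(2) by auto
      then have "Y closure_of {b} \<subseteq> Y closure_of {y}"
        by (intro closure_of_minimal) auto
      then have "f ` h {b} \<subseteq> f ` h {y}" by (auto simp: h_def)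
      then have "Y closure_of (f ` h {b}) \<subseteq> Y closure_of (f ` h {y})" by (rule closure_of_mono)
      moreover have "b \<in> Y closure_of {b}" "Y closure_of {b} = Y closure_of (f ` h {b})"
        using b closure_of_subset[of "{b}" Y] by (auto simp: Y0_def)
      ultimately show "b \<in> Y closure_of (f ` h {y})" by blast
    qed
    then have "Y closure_of {y} \<subseteq> Y closure_of (f ` h {y})"
      using closure_of_minimal[of "g ` A'"] y(2) by (metis closedin_closure_of)
    moreover have "Y closure_of (f ` h {y}) \<subseteq> Y closure_of {y}"
      by (rule closure_of_minimal) (auto simp: h_def)
    ultimately have "y \<in> Y0" using y(1) by (auto simp: Y0_def)
    then show "\<exists>z\<in>topspace Z. g z = y" using gk tZ by blast
  qed (fact iffD1[OF opZ])
  have AX: "A \<subseteq> topspace X" using A closedin_subset by (auto simp: WD_def)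
  have kf: "continuous_map X Z (k \<circ> f)"
    unfolding Z_def
  proof (rule continuous_map_pullback')
    show "continuous_map X Y (g \<circ> (k \<circ> f))"
      by (rule continuous_map_eq[OF f]) (simp add: gk fY0)
    show "topspace X \<subseteq> (k \<circ> f) -` k ` Y0" using fY0 by auto
  qed
  have "\<exists>!c. c \<in> topspace Z \<and> Z closure_of ((k \<circ> f) ` A) = Z closure_of {c}"
    by (rule conjunct2[OF A[unfolded WD_def mem_Collect_eq], rule_format, OF conjI[OF wfZ kf]])
  then obtain c where c: "c \<in> topspace Z" "Z closure_of ((k \<circ> f) ` A) = Z closure_of {c}"
    by (elim ex1E conjE)
  have gimg: "Y closure_of (g ` (Z closure_of S)) = Y closure_of (g ` S)" if "S \<subseteq> topspace Z" for S
  proof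
    show "Y closure_of (g ` (Z closure_of S)) \<subseteq> Y closure_of (g ` S)"
      by (rule closure_of_minimal[OF continuous_map_image_closure_subset[OF gcont] closedin_closure_of])
    show "Y closure_of (g ` S) \<subseteq> Y closure_of (g ` (Z closure_of S))"
      by (rule closure_of_mono[OF image_mono[OF closure_of_subset[OF that]]])
  qed
  have gkf: "g ` (k \<circ> f) ` A = f ` A"
    unfolding image_image
  proof (rule image_cong[OF refl])
    fix x assume "x \<in> A"
    then have "f x \<in> Y0" using AX fY0 by blast
    then show "g ((k \<circ> f) x) = f x" by (simp add: gk)
  qed
  have kfZ: "(k \<circ> f) ` A \<subseteq> topspace Z" using AX fY0 tZ by auto
  have "Y closure_of (f ` A) = Y closure_of (g ` (Z closure_of {c}))"
    unfolding c(2)[symmetric] gimg[OF kfZ] gkf ..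
  also have "\<dots> = Y closure_of {g c}" using gimg[of "{c}"] c(1) by simp
  finally have fA: "Y closure_of (f ` A) = Y closure_of {g c}" .
  have gc: "g c \<in> topspace Y" using c(1) gY tZ by simp
  show ?thesis
  proof (rule ex1I[of _ "g c"])
    show "g c \<in> topspace Y \<and> Y closure_of (f ` A) = Y closure_of {g c}" using fA gc by blast
    fix y assume y: "y \<in> topspace Y \<and> Y closure_of (f ` A) = Y closure_of {y}"
    show "y = g c"
      by (rule t0_closure_inj[OF t0 conjunct1[OF y] gc trans[OF conjunct2[OF y, symmetric] fA]])
  qed
qed

end

theory Submission
  imports Defs
begin

text \<open>
  In a well-filtered space every Rudin set, and every well-filtered determined set, is the closure
  of a single point \<open>y\<close>, that is, the principal ideal below \<open>y\<close>. The trace of such an ideal on an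
  upper set \<open>K\<close> generates the whole ideal if \<open>y \<in> K\<close> and is empty otherwise, so it is closed in
  either case (\<open>closedin_down_point_closure_Int\<close>).

  Conversely, suppose that a filtered family of compact saturated sets has its intersection in an
  open set \<open>U\<close> but no member inside \<open>U\<close>. Zorn's lemma yields a minimal closed set \<open>A\<close> that misses
  \<open>U\<close> and meets every member, so \<open>A\<close> is a Rudin set. For each member \<open>K\<close>, the lower closure of
  \<open>A \<inter> K\<close> is assumed closed; it lies in \<open>A\<close> and still meets every member, so by minimality it is
  all of \<open>A\<close>. A maximal point of \<open>A\<close>, which exists because closed subsets of a d-space are closed
  under directed suprema, must therefore lie in every \<open>K\<close>, hence in \<open>U\<close>: a contradiction
  (\<open>well_filtered_if_RD_traces_closed\<close>).

  The four conditions are ordered by \<open>RD_subset_WD\<close> and \<open>compact_saturated_subset_up_sets\<close>: the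
  one on well-filtered determined sets and upper sets is the strongest, the one on Rudin sets and
  compact saturated sets the weakest. So it suffices to derive the strongest one from
  well-filteredness, and well-filteredness from the weakest one.
\<close>

section \<open>Specialization order, upper sets and lower closures\<close>

lemma spec_le_iff_closure_subset:
  assumes "x \<in> topspace X"
  shows "spec_le X x y \<longleftrightarrow> X closure_of {x} \<subseteq> X closure_of {y}"
proof
  assume "spec_le X x y"
  then show "X closure_of {x} \<subseteq> X closure_of {y}"
    unfolding spec_le_def by (intro closure_of_minimal) auto
next
  assume "X closure_of {x} \<subseteq> X closure_of {y}"
  moreover have "x \<in> X closure_of {x}"
    using assms closure_of_subset[of "{x}" X] by auto
  ultimately show "spec_le X x y"
    unfolding spec_le_def by blast
qed

lemma compact_saturated_subset_up_sets: "compact_saturated_sets X \<subseteq> up_sets X"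
proof
  fix K assume K: "K \<in> compact_saturated_sets X"
  then have sat: "saturated_in X K" and "K \<subseteq> topspace X" "K \<noteq> {}"
    by (auto simp: compact_saturated_sets_def compactin_subset_topspace)
  moreover have "y \<in> K" if "x \<in> K" "y \<in> topspace X" "spec_le X x y" for x y
    using saturated_in_upward[OF sat] that unfolding spec_le_def by blast
  ultimately show "K \<in> up_sets X"
    by (auto simp: up_sets_def upper_in_def)
qed

lemma down_subset_closed:
  assumes "closedin X A" "S \<subseteq> A"
  shows "down X S \<subseteq> A"
proof -
  have "X closure_of {s} \<subseteq> A" if "s \<in> S" for s
    using assms that by (intro closure_of_minimal) auto
  then show ?thesis
    unfolding lower_closure_in_def spec_le_def by blast
qed

section \<open>Rudin sets are well-filtered determined\<close>

text \<open>
  The saturated images of the traces \<open>A \<inter> K\<close> form a filtered family of compact saturated sets in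
  \<open>Y\<close>, each meeting the closure of \<open>f ` A\<close>. Well-filteredness puts a point \<open>y\<close> of that closure into
  all of them, and minimality of \<open>A\<close> then forces \<open>f ` A\<close> below \<open>y\<close>.
\<close>

lemma RD_image_closure_is_point_closure:
  assumes A: "A \<in> RD X" and wf: "well_filtered_space Y" and f: "continuous_map X Y f"
  shows "\<exists>y\<in>topspace Y. Y closure_of (f ` A) = Y closure_of {y}"
proof -
  have clA: "closedin X A" using A by (simp add: RD_def)
  obtain \<K> where \<K>: "\<K> \<subseteq> compact_saturated_sets X" "filtered_family \<K>"
    and meets: "\<And>K. K \<in> \<K> \<Longrightarrow> A \<inter> K \<noteq> {}"
    and min: "\<And>C. C \<in> closed_meeting X \<K> \<Longrightarrow> C \<subseteq> A \<Longrightarrow> C = A"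
    using A by (auto simp: RD_def closed_meeting_def)
  have AX: "A \<subseteq> topspace X" using clA closedin_subset by blast
  have fA: "f ` A \<subseteq> topspace Y" using AX f by (auto simp: continuous_map_def)
  define S where "S K = saturation Y (f ` (A \<inter> K))" for K
  have comp: "S ` \<K> \<subseteq> compact_saturated_sets Y"
  proof
    fix T assume "T \<in> S ` \<K>"
    then obtain K where K: "K \<in> \<K>" "T = S K" by blast
    have "compactin X K" using \<K>(1) K(1) by (auto simp: compact_saturated_sets_def)
    then have "compactin Y (f ` (A \<inter> K))"
      using clA f by (meson closed_Int_compactin image_compactin)
    then show "T \<in> compact_saturated_sets Y"
      unfolding K(2) S_def using meets[OF K(1)] by (intro saturation_compact_saturated) auto
  qed
  have filt: "filtered_family (S ` \<K>)"
    unfolding filtered_family_def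
  proof (intro conjI ballI)
    show "S ` \<K> \<noteq> {}" using \<K>(2) by (auto simp: filtered_family_def)
    fix T1 T2 assume "T1 \<in> S ` \<K>" "T2 \<in> S ` \<K>"
    then obtain K1 K2 where K: "K1 \<in> \<K>" "K2 \<in> \<K>" "T1 = S K1" "T2 = S K2" by blast
    then obtain K3 where K3: "K3 \<in> \<K>" "K3 \<subseteq> K1" "K3 \<subseteq> K2"
      using \<K>(2) unfolding filtered_family_def by blast
    have "S K3 \<subseteq> T1" "S K3 \<subseteq> T2"
      unfolding K S_def by (rule saturation_mono; use K3 in blast)+
    then show "\<exists>T3\<in>S ` \<K>. T3 \<subseteq> T1 \<and> T3 \<subseteq> T2" using K3(1) by blast
  qed
  define W where "W = topspace Y - Y closure_of (f ` A)"
  have "openin Y W" by (simp add: W_def openin_diff)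
  moreover have "\<not> S K \<subseteq> W" if K: "K \<in> \<K>" for K
  proof -
    obtain a where "a \<in> A" "a \<in> K" using meets[OF K] by blast
    then have "f a \<in> S K" "f a \<notin> W"
      using fA saturation_superset[of "f ` (A \<inter> K)" Y] closure_of_subset[OF fA]
      by (auto simp: S_def W_def)
    then show ?thesis by blast
  qed
  ultimately have "\<not> \<Inter>(S ` \<K>) \<subseteq> W"
    using wf comp filt unfolding well_filtered_space_def by (metis (full_types) imageE)
  then obtain y where y: "\<And>K. K \<in> \<K> \<Longrightarrow> y \<in> S K" "y \<notin> W" by blast
  have "\<K> \<noteq> {}" using \<K>(2) by (simp add: filtered_family_def)
  then have yY: "y \<in> topspace Y" using y(1) by (auto simp: S_def saturation_def)
  then have ycl: "y \<in> Y closure_of (f ` A)" using y(2) by (simp add: W_def)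
  define B where "B = A \<inter> {x \<in> topspace X. f x \<in> Y closure_of {y}}"
  have "closedin X {x \<in> topspace X. f x \<in> Y closure_of {y}}"
    using f closedin_continuous_map_preimage closedin_closure_of by blast
  then have "closedin X B" using clA by (simp add: B_def closedin_Int)
  moreover have "B \<inter> K \<noteq> {}" if "K \<in> \<K>" for K
  proof -
    have "Y closure_of {y} \<inter> f ` (A \<inter> K) \<noteq> {}"
      using saturation_closure_meets[of y Y "f ` (A \<inter> K)"] y(1)[OF that] fA by (auto simp: S_def)
    then show ?thesis using AX by (auto simp: B_def)
  qed
  ultimately have "B \<in> closed_meeting X \<K>" by (simp add: closed_meeting_def)
  then have "B = A" using min by (simp add: B_def)
  then have "f ` A \<subseteq> Y closure_of {y}" by (auto simp: B_def)
  then have "Y closure_of (f ` A) = Y closure_of {y}"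
    using ycl by (intro subset_antisym closure_of_minimal) auto
  then show ?thesis using yY by blast
qed

lemma RD_subset_WD: "RD X \<subseteq> WD X"
proof
  fix A assume A: "A \<in> RD X"
  have "\<exists>!y. y \<in> topspace Y \<and> Y closure_of (f ` A) = Y closure_of {y}"
    if Y: "well_filtered_space Y" "continuous_map X Y f" for Y :: "'a set topology" and f
  proof -
    have "t0_space Y" using Y(1) by (simp add: well_filtered_space_def)
    then show ?thesis
      using RD_image_closure_is_point_closure[OF A Y] t0_closure_inj[of Y] by metis
  qed
  moreover have "closedin X A" using A by (simp add: RD_def)
  ultimately show "A \<in> WD X" by (simp add: WD_def)
qed

section \<open>Traces on upper sets in well-filtered spaces\<close>

lemma WD_point_closure_if_well_filtered:
  assumes "well_filtered_space X" "A \<in> WD X"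
  shows "\<exists>y\<in>topspace X. A = X closure_of {y}"
proof -
  have "\<exists>y. y \<in> topspace X \<and> X closure_of (id ` A) = X closure_of {y}"
    using WD_all_spaces[OF assms(2,1) continuous_map_id] by blast
  moreover have "X closure_of A = A"
    using assms(2) by (simp add: WD_def closure_of_closedin)
  ultimately show ?thesis by auto
qed

lemma closedin_down_point_closure_Int:
  assumes y: "y \<in> topspace X" and K: "upper_in (topspace X) (spec_le X) K"
  shows "closedin X (down X (X closure_of {y} \<inter> K))"
proof (cases "y \<in> K")
  case True
  have "y \<in> X closure_of {y}"
    using y closure_of_subset[of "{y}" X] by auto
  then have "X closure_of {y} \<subseteq> down X (X closure_of {y} \<inter> K)"
    using True closure_of_subset_topspace[of X "{y}"]
    by (auto simp: lower_closure_in_def spec_le_def)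
  moreover have "down X (X closure_of {y} \<inter> K) \<subseteq> X closure_of {y}"
    by (rule down_subset_closed) auto
  ultimately have "down X (X closure_of {y} \<inter> K) = X closure_of {y}" by blast
  then show ?thesis by simp
next
  case False
  then have "X closure_of {y} \<inter> K = {}"
    using K y unfolding upper_in_def spec_le_def by blast
  then show ?thesis by (simp add: lower_closure_in_def)
qed

section \<open>Maximal points of closed sets in d-spaces\<close>

lemma d_space_closed_directed_sup:
  assumes "d_space X" "closedin X A" "directed_in (topspace X) (spec_le X) D" "D \<subseteq> A"
    "is_sup_in (topspace X) (spec_le X) D s"
  shows "s \<in> A"
proof (rule ccontr)
  assume "s \<notin> A"
  then have "s \<in> topspace X - A" using assms(5) by (simp add: is_sup_in_def)
  moreover have "scott_open_in (topspace X) (spec_le X) (topspace X - A)"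
    using assms(1,2) by (auto simp: d_space_def)
  ultimately have "D \<inter> (topspace X - A) \<noteq> {}"
    using assms(3,5) unfolding scott_open_in_def by blast
  then show False using assms(4) by blast
qed

text \<open>
  Since \<open>spec_le\<close> is inclusion of point closures, Zorn's lemma can be applied to the family of
  closures of points of \<open>A\<close>, ordered by inclusion.
\<close>

lemma d_space_closed_has_maximal_point:
  assumes d: "d_space X" and A: "closedin X A" "A \<noteq> {}"
  obtains m where "m \<in> A" "\<And>s. s \<in> A \<Longrightarrow> spec_le X m s \<Longrightarrow> spec_le X s m"
proof -
  define cl where "cl x = X closure_of {x}" for x
  have AX: "A \<subseteq> topspace X" using A(1) closedin_subset by blast
  have le: "spec_le X x y \<longleftrightarrow> cl x \<subseteq> cl y" if "x \<in> A" for x y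
    using AX that spec_le_iff_closure_subset[of x X y] unfolding cl_def by blast
  have "\<exists>M\<in>cl ` A. \<forall>C\<in>cl ` A. M \<subseteq> C \<longrightarrow> C = M"
  proof (rule subset_Zorn)
    fix \<C> assume chain: "subset.chain (cl ` A) \<C>"
    show "\<exists>B\<in>cl ` A. \<forall>C\<in>\<C>. C \<subseteq> B"
    proof (cases "\<C> = {}")
      case True
      then show ?thesis using A(2) by blast
    next
      case False
      define D where "D = {a \<in> A. cl a \<in> \<C>}"
      have img: "\<C> = cl ` D" using chain by (auto simp: D_def subset.chain_def)
      have linear: "cl a \<subseteq> cl b \<or> cl b \<subseteq> cl a" if "a \<in> D" "b \<in> D" for a b
        using chain that unfolding subset_chain_def D_def by blast
      have "D \<subseteq> A" by (auto simp: D_def)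
      have dir: "directed_in (topspace X) (spec_le X) D"
        unfolding directed_in_def
      proof (intro conjI ballI)
        show "D \<subseteq> topspace X" "D \<noteq> {}" using \<open>D \<subseteq> A\<close> AX img False by auto
        fix a b assume ab: "a \<in> D" "b \<in> D"
        then have "a \<in> A" "b \<in> A" using \<open>D \<subseteq> A\<close> by auto
        then show "\<exists>c\<in>D. spec_le X a c \<and> spec_le X b c"
          using linear[OF ab] ab le by blast
      qed
      then obtain s where s: "is_sup_in (topspace X) (spec_le X) D s"
        using d unfolding d_space_def dcpo_on_def by blast
      have "s \<in> A" using d_space_closed_directed_sup[OF d A(1) dir \<open>D \<subseteq> A\<close> s] .
      moreover have "cl a \<subseteq> cl s" if "a \<in> D" for a
        using s that \<open>D \<subseteq> A\<close> le unfolding is_sup_in_def by blast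
      ultimately show ?thesis using img by blast
    qed
  qed
  then obtain m where m: "m \<in> A" "\<And>s. s \<in> A \<Longrightarrow> cl m \<subseteq> cl s \<Longrightarrow> cl s = cl m" by blast
  show thesis
  proof (rule that[OF m(1)])
    fix s assume "s \<in> A" "spec_le X m s"
    then show "spec_le X s m" using m le by simp
  qed
qed

section \<open>Well-filteredness from closed traces\<close>

text \<open>
  Minimality makes the set below a closed trace \<open>A \<inter> K\<close> equal to \<open>A\<close>, so \<open>A \<inter> K\<close> contains every
  maximal point of \<open>A\<close>, for each member \<open>K\<close> at once.
\<close>

lemma well_filtered_if_RD_traces_closed:
  assumes d: "d_space X"
    and traces: "\<And>A K. A \<in> RD X \<Longrightarrow> K \<in> compact_saturated_sets X \<Longrightarrow> closedin X (down X (A \<inter> K))"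
  shows "well_filtered_space X"
  unfolding well_filtered_space_def
proof (intro conjI allI impI)
  show "t0_space X" using d by (simp add: d_space_def)
  fix U \<K>
  assume *: "openin X U \<and> \<K> \<subseteq> compact_saturated_sets X \<and> filtered_family \<K> \<and> \<Inter>\<K> \<subseteq> U"
  show "\<exists>K\<in>\<K>. K \<subseteq> U"
  proof (rule ccontr)
    assume no: "\<not> (\<exists>K\<in>\<K>. K \<subseteq> U)"
    have comp: "\<forall>K\<in>\<K>. compactin X K" using * by (auto simp: compact_saturated_sets_def)
    have "(topspace X - U) \<inter> K \<noteq> {}" if "K \<in> \<K>" for K
      using no comp compactin_subset_topspace that by blast
    then have "topspace X - U \<in> closed_meeting X \<K>"
      using * by (simp add: closed_meeting_def closedin_diff)
    then obtain A where A: "A \<in> closed_meeting X \<K>" "A \<subseteq> topspace X - U"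
      and min: "\<And>B. B \<in> closed_meeting X \<K> \<Longrightarrow> B \<subseteq> A \<Longrightarrow> B = A"
      using closed_meeting_minimal[OF comp] by blast
    have clA: "closedin X A" and meets: "\<And>K. K \<in> \<K> \<Longrightarrow> A \<inter> K \<noteq> {}"
      using A(1) by (auto simp: closed_meeting_def)
    have "\<K> \<noteq> {}" using * by (simp add: filtered_family_def)
    then have ne: "A \<noteq> {}" using meets by blast
    have RD: "A \<in> RD X"
      unfolding RD_def using ne clA * A(1) min by blast
    have down_eq: "down X (A \<inter> K) = A" if K: "K \<in> \<K>" for K
    proof (rule min)
      show "down X (A \<inter> K) \<subseteq> A" using clA by (rule down_subset_closed) auto
      have sub: "A \<inter> K \<subseteq> down X (A \<inter> K)"
        using closedin_subset[OF clA] spec_le_iff_closure_subset[of _ X]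
        unfolding lower_closure_in_def by blast
      have "down X (A \<inter> K) \<inter> K' \<noteq> {}" if K': "K' \<in> \<K>" for K'
      proof -
        obtain K3 where K3: "K3 \<in> \<K>" "K3 \<subseteq> K" "K3 \<subseteq> K'"
          using * K K' unfolding filtered_family_def by blast
        then show ?thesis using meets[OF K3(1)] sub by blast
      qed
      moreover have "closedin X (down X (A \<inter> K))" using traces[OF RD] * K by blast
      ultimately show "down X (A \<inter> K) \<in> closed_meeting X \<K>" by (simp add: closed_meeting_def)
    qed
    obtain m where m: "m \<in> A" "\<And>s. s \<in> A \<Longrightarrow> spec_le X m s \<Longrightarrow> spec_le X s m"
      using d_space_closed_has_maximal_point[OF d clA ne] by blast
    have "m \<in> K" if K: "K \<in> \<K>" for K
    proof -
      obtain s where s: "s \<in> A" "s \<in> K" "spec_le X m s"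
        using m(1) down_eq[OF K] unfolding lower_closure_in_def by blast
      have "upper_in (topspace X) (spec_le X) K"
        using compact_saturated_subset_up_sets[of X] * K by (auto simp: up_sets_def)
      then show ?thesis
        using s m closedin_subset[OF clA] unfolding upper_in_def by blast
    qed
    then have "m \<in> U" using * by blast
    then show False using m(1) A(2) by blast
  qed
qed

theorem corollary3p10:
  fixes X :: "'a topology"
  assumes "d_space X"
  shows
    "(well_filtered_space X \<longleftrightarrow>
        (\<forall>A\<in>WD X. \<forall>K\<in>up_sets X. closedin X (down X (A \<inter> K)))) \<and>
     (well_filtered_space X \<longleftrightarrow>
        (\<forall>A\<in>RD X. \<forall>K\<in>up_sets X. closedin X (down X (A \<inter> K)))) \<and>
     (well_filtered_space X \<longleftrightarrow>
        (\<forall>A\<in>WD X. \<forall>K\<in>compact_saturated_sets X. closedin X (down X (A \<inter> K)))) \<and>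
     (well_filtered_space X \<longleftrightarrow>
        (\<forall>A\<in>RD X. \<forall>K\<in>compact_saturated_sets X. closedin X (down X (A \<inter> K))))"
proof -
  let ?traces = "\<lambda>\<A> \<K>. \<forall>A\<in>\<A>. \<forall>K\<in>\<K>. closedin X (down X (A \<inter> K))"
  have strongest: "?traces (WD X) (up_sets X)" if wf: "well_filtered_space X"
  proof (intro ballI)
    fix A K assume A: "A \<in> WD X" and K: "K \<in> up_sets X"
    obtain y where "y \<in> topspace X" "A = X closure_of {y}"
      using WD_point_closure_if_well_filtered[OF wf A] by blast
    then show "closedin X (down X (A \<inter> K))"
      using closedin_down_point_closure_Int[of y X K] K by (simp add: up_sets_def)
  qed
  have weakest: "well_filtered_space X" if "?traces (RD X) (compact_saturated_sets X)"
    using well_filtered_if_RD_traces_closed[OF assms] that by blast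
  have weaken: "?traces \<A>' \<K>'" if "?traces \<A> \<K>" "\<A>' \<subseteq> \<A>" "\<K>' \<subseteq> \<K>" for \<A> \<A>' \<K> \<K>'
    using that by blast
  note RD_WD = RD_subset_WD[of X] and comp_up = compact_saturated_subset_up_sets[of X]
  show ?thesis
  proof (intro conjI iffI)
    assume wf: "well_filtered_space X"
    show "?traces (WD X) (up_sets X)" by (rule strongest[OF wf])
    show "?traces (RD X) (up_sets X)" by (rule weaken[OF strongest[OF wf] RD_WD order_refl])
    show "?traces (WD X) (compact_saturated_sets X)"
      by (rule weaken[OF strongest[OF wf] order_refl comp_up])
    show "?traces (RD X) (compact_saturated_sets X)"
      by (rule weaken[OF strongest[OF wf] RD_WD comp_up])
  next
    assume "?traces (WD X) (up_sets X)"
    then show "well_filtered_space X" by (rule weakest[OF weaken[OF _ RD_WD comp_up]])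
  next
    assume "?traces (RD X) (up_sets X)"
    then show "well_filtered_space X" by (rule weakest[OF weaken[OF _ order_refl comp_up]])
  next
    assume "?traces (WD X) (compact_saturated_sets X)"
    then show "well_filtered_space X" by (rule weakest[OF weaken[OF _ RD_WD order_refl]])
  next
    assume "?traces (RD X) (compact_saturated_sets X)"
    then show "well_filtered_space X" by (rule weakest)
  qed
qed

end
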